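(* Let $n\in\{4,5\}$ and let $f$ be a real $n\times n$ antisymmetric matrix. Define $$\Delta=\mathrm{tr}(f^4)-\tfrac14\bigl(\mathrm{tr}(f^2)\bigr)^2,\qquad \theta_\pm^2=-\tfrac14\mathrm{tr}(f^2)\pm\tfrac12\sqrt{\Delta},\qquad \theta_\pm=\sqrt{\theta_\pm^2}$$ (the quantities $\Delta$ and $\theta_\pm^2$ are nonnegative, so $\sqrt{\Delta}$ and $\theta_\pm$ denote nonnegative real square roots). If $\Delta\neq 0$ and both $\theta_+\neq 0$ and $\theta_-\neq 0$, then $$\exp(f)=I+\frac{1}{\sqrt{\Delta}}\bigl(Af+Bf^2+Cf^3+Df^4\bigr),$$ where $$A=\frac{\theta_+^2\sin\theta_-}{\theta_-}-\frac{\theta_-^2\sin\theta_+}{\theta_+},\qquad B=\frac{\theta_+^2(1-\cos\theta_-)}{\theta_-^2}-\frac{\theta_-^2(1-\cos\theta_+)}{\theta_+^2},$$ $$C=\frac{\sin\theta_-}{\theta_-}-\frac{\sin\theta_+}{\theta_+},\qquad D=\frac{1-\cos\theta_-}{\theta_-^2}-\frac{1-\cos\theta_+}{\theta_+^2}.$$ Moreover, if $\Delta=0$ and $\theta_+\neq 0$, then $$\exp(f)=I+\frac{\sin\theta_+}{\theta_+}f+\frac{1-\cos\theta_+}{\theta_+^2}f^2.$$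
   Context: $\exp(A)=\sum_{k\ge 0}A^k/k!$ is the matrix exponential, $I$ is the identity matrix, and $\mathrm{tr}$ is the trace. A matrix $f$ is antisymmetric if $f^t=-f$. *)

theory Defs
  imports "HOL-Analysis.Analysis"
begin

text \<open>On \<open>real^'n^'n\<close> the library operations \<open>*\<close> and \<open>^\<close> act componentwise, so powers for the
  matrix product \<open>**\<close> are defined here, and \<open>exp\<close> from the library is not available.\<close>

primrec matpow :: "real^'n^'n \<Rightarrow> nat \<Rightarrow> real^'n^'n" where
  "matpow A 0 = mat 1"
| "matpow A (Suc k) = A ** matpow A k"

definition matexp :: "real^'n^'n \<Rightarrow> real^'n^'n" where
  "matexp A = (\<Sum>k. (1 / fact k) *\<^sub>R matpow A k)"

lemma matpow_component_bound:
  fixes A :: "real^'n^'n"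
  shows "\<bar>matpow A k $ i $ j\<bar> \<le> (real CARD('n) * norm A) ^ k"
proof (induction k arbitrary: i j)
  case 0
  show ?case by (simp add: mat_def)
next
  case (Suc k)
  have entry: "\<bar>A $ i $ l\<bar> \<le> norm A" for l
    using Finite_Cartesian_Product.norm_nth_le[of "A $ i" l]
      Finite_Cartesian_Product.norm_nth_le[of A i] by simp
  have "\<bar>matpow A (Suc k) $ i $ j\<bar> \<le> (\<Sum>l\<in>UNIV. \<bar>A $ i $ l * matpow A k $ l $ j\<bar>)"
    by (simp add: matrix_matrix_mult_def)
  also have "\<dots> \<le> (\<Sum>l\<in>(UNIV :: 'n set). norm A * (real CARD('n) * norm A) ^ k)"
    unfolding abs_mult by (intro sum_mono mult_mono entry Suc.IH) auto
  also have "\<dots> = (real CARD('n) * norm A) ^ Suc k"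
    by simp
  finally show ?case .
qed

text \<open>The exponential series converges, so \<open>matexp\<close> is its actual sum.\<close>

lemma summable_matexp:
  fixes A :: "real^'n^'n"
  shows "summable (\<lambda>k. (1 / fact k) *\<^sub>R matpow A k)"
proof -
  define c where "c = real CARD('n) * norm A"
  let ?N = "real CARD('n)"
  have "summable (\<lambda>k. ?N * ?N * (inverse (fact k) * c ^ k))"
    by (intro summable_mult summable_exp)
  moreover have "norm ((1 / fact k) *\<^sub>R matpow A k) \<le> ?N * ?N * (inverse (fact k) * c ^ k)" for k
  proof -
    have row: "norm (matpow A k $ i) \<le> ?N * c ^ k" for i
    proof -
      have "norm (matpow A k $ i) \<le> (\<Sum>j\<in>UNIV. \<bar>matpow A k $ i $ j\<bar>)"
        by (rule norm_le_l1_cart)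
      also have "\<dots> \<le> (\<Sum>j\<in>(UNIV :: 'n set). c ^ k)"
        unfolding c_def by (intro sum_mono matpow_component_bound)
      finally show ?thesis by simp
    qed
    have "norm (matpow A k) \<le> (\<Sum>i\<in>UNIV. norm (matpow A k $ i))"
      unfolding norm_vec_def by (rule L2_set_le_sum) simp
    also have "\<dots> \<le> (\<Sum>i\<in>(UNIV :: 'n set). ?N * c ^ k)"
      by (intro sum_mono row)
    finally have "norm (matpow A k) \<le> ?N * ?N * c ^ k" by simp
    then show ?thesis
      by (simp add: field_simps)
  qed
  ultimately show ?thesis
    by (rule summable_comparison_test'[where N = 0])
qed

definition antisymmetric :: "real^'n^'n \<Rightarrow> bool" where
  "antisymmetric f \<longleftrightarrow> transpose f = - f"

definition Delta :: "real^'n^'n \<Rightarrow> real" where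
  "Delta f = trace (matpow f 4) - 1/4 * (trace (matpow f 2))\<^sup>2"

definition theta_plus_sq :: "real^'n^'n \<Rightarrow> real" where
  "theta_plus_sq f = - 1/4 * trace (matpow f 2) + 1/2 * sqrt (Delta f)"

definition theta_minus_sq :: "real^'n^'n \<Rightarrow> real" where
  "theta_minus_sq f = - 1/4 * trace (matpow f 2) - 1/2 * sqrt (Delta f)"

definition theta_plus :: "real^'n^'n \<Rightarrow> real" where
  "theta_plus f = sqrt (theta_plus_sq f)"

definition theta_minus :: "real^'n^'n \<Rightarrow> real" where
  "theta_minus f = sqrt (theta_minus_sq f)"

definition coeff_A :: "real^'n^'n \<Rightarrow> real" where
  "coeff_A f = theta_plus_sq f * sin (theta_minus f) / theta_minus f
             - theta_minus_sq f * sin (theta_plus f) / theta_plus f"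

definition coeff_B :: "real^'n^'n \<Rightarrow> real" where
  "coeff_B f = theta_plus_sq f * (1 - cos (theta_minus f)) / theta_minus_sq f
             - theta_minus_sq f * (1 - cos (theta_plus f)) / theta_plus_sq f"

definition coeff_C :: "real^'n^'n \<Rightarrow> real" where
  "coeff_C f = sin (theta_minus f) / theta_minus f - sin (theta_plus f) / theta_plus f"

definition coeff_D :: "real^'n^'n \<Rightarrow> real" where
  "coeff_D f = (1 - cos (theta_minus f)) / theta_minus_sq f
             - (1 - cos (theta_plus f)) / theta_plus_sq f"

end

theory Submission
  imports Defs
begin

text \<open>Write \<open>a = \<theta>\<^sub>+\<^sup>2\<close> and \<open>b = \<theta>\<^sub>-\<^sup>2\<close>. Everything rests on one identity, valid for every
antisymmetric \<open>f\<close> of size at most five (\<open>antisymmetric_quintic\<close>):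
\<open>f\<^sup>5 + (a + b) f\<^sup>3 + a b f = 0\<close>.
Instead of going through the characteristic polynomial and Newton's identities, it is read off from
Pfaffians: a \<open>6 \<times> 6\<close> Pfaffian of entries of \<open>f\<close> must repeat an index, hence vanishes, and
contracting this Pfaffian with two further copies of \<open>f\<close> turns its fifteen terms into traces and
powers of \<open>f\<close>. All sizes up to five are thereby treated at once, without coordinates and
without a spectral theorem.

The three nonnegativity claims follow. The sum of the squares of the \<open>4 \<times> 4\<close> Pfaffians over all index quadruples is
\<open>24 a b\<close>, so \<open>a b \<ge> 0\<close>; as \<open>a + b\<close> is half the squared Frobenius norm of \<open>f\<close>, this gives
\<open>b \<ge> 0\<close>. For \<open>\<Delta> \<ge> 0\<close>, the quintic identity shows that \<open>H = f\<^sup>3 + \<onehalf>(a + b) f\<close> satisfies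
\<open>\<parallel>H\<parallel>\<^sup>2 = \<Delta>/4 \<parallel>f\<parallel>\<^sup>2\<close>. The same formula settles the degenerate case: if \<open>\<Delta> = 0\<close> then
\<open>H = 0\<close>, that is \<open>f\<^sup>3 = -a f\<close>.

For the exponential, \<open>f\<close> is split as \<open>U + V\<close> with \<open>f\<^sup>2 U = -b U\<close> and \<open>f\<^sup>2 V = -a V\<close>; these are its
two plane rotation parts, obtained as polynomials in \<open>f\<close>:
\<open>U = (f\<^sup>3 + a f)/\<surd>\<Delta>\<close> and \<open>V = -(f\<^sup>3 + b f)/\<surd>\<Delta>\<close>, where \<open>\<surd>\<Delta> = a - b\<close>.
On each part the powers of \<open>f\<close> oscillate, and the exponential series separates into a sine and a
cosine series (\<open>matexp_sum_oscillating\<close>). When \<open>\<Delta> = 0\<close> the single part \<open>f\<close> itself suffices.\<close>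

section \<open>Algebra of antisymmetric matrices\<close>

lemma matrix_scaleR_right:
  fixes A :: "real^'n^'m" and B :: "real^'p^'n"
  shows "A ** (c *\<^sub>R B) = c *\<^sub>R (A ** B)"
  by (simp add: matrix_matrix_mult_def vec_eq_iff sum_distrib_left mult.left_commute)

lemma matrix_diff_ldistrib:
  fixes A :: "real^'n^'m" and B C :: "real^'p^'n"
  shows "A ** (B - C) = A ** B - A ** C"
  by (simp add: matrix_matrix_mult_def vec_eq_iff right_diff_distrib sum_subtractf)

lemma matpow_numerals:
  "matpow f 2 = f ** f"
  "matpow f 3 = f ** (f ** f)"
  "matpow f 4 = f ** (f ** (f ** f))"
  "matpow f 5 = f ** (f ** (f ** (f ** f)))"
  by (simp_all add: numeral_eq_Suc)

lemma antisymmetric_nth: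
  assumes "antisymmetric f"
  shows "f$i$j = - f$j$i"
proof -
  have "transpose f $ j $ i = (- f) $ j $ i"
    using assms by (simp add: antisymmetric_def)
  then show ?thesis by (simp add: transpose_def)
qed

lemma trace_mult_transpose:
  fixes A B :: "real^'n^'n"
  shows "trace (A ** transpose B) = A \<bullet> B"
  by (simp add: trace_def matrix_matrix_mult_def transpose_def inner_vec_def)

text \<open>Skew-adjointness for the Frobenius inner product, by cyclicity of the trace.\<close>

lemma inner_antisymmetric_mult:
  fixes f X Y :: "real^'n^'n"
  assumes "antisymmetric f"
  shows "(f ** X) \<bullet> Y = - (X \<bullet> (f ** Y))"
proof -
  have tf: "transpose f = - f" using assms by (simp add: antisymmetric_def)
  have "X \<bullet> (f ** Y) = trace (X ** (transpose Y ** transpose f))"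
    by (simp only: trace_mult_transpose [symmetric] matrix_transpose_mul)
  also have "\<dots> = trace (transpose f ** (X ** transpose Y))"
    by (metis trace_mul_sym matrix_mul_assoc)
  also have "\<dots> = - trace (f ** X ** transpose Y)"
    unfolding tf matrix_mul_assoc by (simp add: trace_def matrix_matrix_mult_def sum_negf)
  finally show ?thesis
    by (simp only: trace_mult_transpose)
qed

lemma trace_square_antisymmetric:
  fixes f :: "real^'n^'n"
  assumes "antisymmetric f"
  shows "trace (matpow f 2) = - (f \<bullet> f)"
  using inner_antisymmetric_mult[OF assms, of "mat 1" f] trace_mult_transpose[of "f ** f" "mat 1"]
  by (simp add: matpow_numerals transpose_mat inner_commute)

section \<open>Pfaffians of four and six indices\<close>

text \<open>Indices may repeat here, so that contractions are sums over the whole index type.\<close>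

definition pf4 :: "real^'n^'n \<Rightarrow> 'n \<Rightarrow> 'n \<Rightarrow> 'n \<Rightarrow> 'n \<Rightarrow> real" where
  "pf4 f a b c d = f$a$b * f$c$d - f$a$c * f$b$d + f$a$d * f$b$c"

text \<open>The expansion along the first row.\<close>

definition pf6 :: "real^'n^'n \<Rightarrow> 'n \<Rightarrow> 'n \<Rightarrow> 'n \<Rightarrow> 'n \<Rightarrow> 'n \<Rightarrow> 'n \<Rightarrow> real" where
  "pf6 f i j k l m n = f$i$j * pf4 f k l m n - f$i$k * pf4 f j l m n + f$i$l * pf4 f j k m n
     - f$i$m * pf4 f j k l n + f$i$n * pf4 f j k l m"

text \<open>A Pfaffian with a repeated index is zero, and five available values cannot make six indices distinct.\<close>

lemma pf6_eq_0:
  fixes f :: "real^'n^'n"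
  assumes "CARD('n) \<le> 5" and f: "antisymmetric f"
  shows "pf6 f i j k l m n = 0"
proof -
  have "\<not> distinct [i, j, k, l, m, n]"
  proof
    assume "distinct [i, j, k, l, m, n]"
    then have "card (set [i, j, k, l, m, n]) = 6"
      by (subst distinct_card) auto
    then show False
      using card_mono[of UNIV "set [i, j, k, l, m, n]"] assms(1) by simp
  qed
  then have *: "i = j \<or> i = k \<or> i = l \<or> i = m \<or> i = n \<or> j = k \<or> j = l \<or> j = m \<or> j = n
      \<or> k = l \<or> k = m \<or> k = n \<or> l = m \<or> l = n \<or> m = n"
    by auto
  note skew = antisymmetric_nth[OF f]
  have diag: "f$a$a = 0" for a
    using skew[of a a] by simp
  \<comment> \<open>Orienting every entry the same way lets the terms cancel in each of the fifteen cases; the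
    instances are explicit because the general rule would rewrite forever.\<close>
  note sort = skew[of j i] skew[of k i] skew[of l i] skew[of m i] skew[of n i]
    skew[of k j] skew[of l j] skew[of m j] skew[of n j] skew[of l k] skew[of m k] skew[of n k]
    skew[of m l] skew[of n l] skew[of n m]
  from * show ?thesis
    unfolding pf6_def pf4_def
    by (elim disjE) (simp_all add: diag sort algebra_simps)
qed

section \<open>Contracting the Pfaffians\<close>

text \<open>The pairing that joins \<open>i\<close> to \<open>j\<close> leaves the closed walk \<open>k, l, k\<close>, a trace; each of the other two joins \<open>i\<close> to \<open>j\<close> by a
walk through \<open>k\<close> and \<open>l\<close>, an entry of the cube.\<close>

lemma pf4_contraction:
  fixes f :: "real^'n^'n"
  assumes f: "antisymmetric f"
  shows "(\<Sum>k\<in>UNIV. \<Sum>l\<in>UNIV. f$k$l * pf4 f i j k l)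
    = - trace (f ** f) * f$i$j + 2 * (f ** (f ** f))$i$j"
proof -
  note skew = antisymmetric_nth[OF f]
  have *: "f$k$l * pf4 f i j k l
      = - (f$k$l * f$l$k) * f$i$j + f$i$k * (f$k$l * f$l$j) + f$i$l * (f$l$k * f$k$j)" for k l
    by (simp add: pf4_def skew[of l k] skew[of l j] skew[of k j] algebra_simps)
  have tr: "(\<Sum>k\<in>UNIV. \<Sum>l\<in>UNIV. - (f$k$l * f$l$k) * f$i$j) = - trace (f ** f) * f$i$j"
    by (simp add: trace_def matrix_matrix_mult_def sum_distrib_right sum_negf)
  have cube: "(\<Sum>k\<in>UNIV. \<Sum>l\<in>UNIV. f$i$k * (f$k$l * f$l$j)) = (f ** (f ** f))$i$j"
    by (simp add: matrix_matrix_mult_def sum_distrib_left)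
  show ?thesis
    unfolding * sum.distrib tr cube
    using sum.swap[of "\<lambda>l k. f$i$l * (f$l$k * f$k$j)" UNIV UNIV] by (simp add: cube)
qed

text \<open>Up to the factor eight this is the product \<open>\<theta>\<^sub>+\<^sup>2 \<theta>\<^sub>-\<^sup>2\<close>, the coefficient of \<open>f\<close> in the quintic identity.\<close>

lemma pf4_double_contraction:
  fixes f :: "real^'n^'n"
  assumes f: "antisymmetric f"
  shows "(\<Sum>i\<in>UNIV. \<Sum>j\<in>UNIV. \<Sum>k\<in>UNIV. \<Sum>l\<in>UNIV. f$i$j * (f$k$l * pf4 f i j k l))
    = (trace (f ** f))\<^sup>2 - 2 * trace (f ** (f ** (f ** f)))"
proof -
  note skew = antisymmetric_nth[OF f]
  let ?t = "trace (f ** f)" and ?c = "f ** (f ** f)"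
  have *: "f$i$j * (- ?t * f$i$j + 2 * ?c$i$j) = ?t * (f$i$j * f$j$i) - 2 * (f$j$i * ?c$i$j)" for i j
    by (simp add: skew[of j i] algebra_simps)
  have tr: "(\<Sum>i\<in>UNIV. \<Sum>j\<in>UNIV. f$i$j * X$j$i) = trace (f ** X)" for X
    by (simp add: trace_def matrix_matrix_mult_def)
  have "(\<Sum>i\<in>UNIV. \<Sum>j\<in>UNIV. f$j$i * ?c$i$j) = trace (f ** ?c)"
    by (subst sum.swap) (rule tr)
  then show ?thesis
    unfolding sum_distrib_left [symmetric] pf4_contraction[OF f] * sum_subtractf
    by (simp only: tr sum_distrib_left [symmetric] power2_eq_square)
qed

text \<open>The difference of the two sides is a third of the sum of the squares of all \<open>pf4 f i j k l\<close>: expanding one factor of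
the square gives three sums, which are equal because \<open>pf4\<close> is alternating.\<close>

lemma trace_fourth_power_le:
  fixes f :: "real^'n^'n"
  assumes f: "antisymmetric f"
  shows "2 * trace (f ** (f ** (f ** f))) \<le> (trace (f ** f))\<^sup>2"
proof -
  note skew = antisymmetric_nth[OF f]
  let ?c = "\<lambda>i j k l. f$i$j * (f$k$l * pf4 f i j k l)"
  let ?S = "\<Sum>i\<in>UNIV. \<Sum>j\<in>UNIV. \<Sum>k\<in>UNIV. \<Sum>l\<in>UNIV. ?c i j k l"
  have "(pf4 f i j k l)\<^sup>2 = ?c i j k l + ?c i k j l + ?c i l j k" for i j k l
    by (simp add: pf4_def skew[of k j] skew[of l j] skew[of l k] power2_eq_square algebra_simps)
  then have "(\<Sum>i\<in>UNIV. \<Sum>j\<in>UNIV. \<Sum>k\<in>UNIV. \<Sum>l\<in>UNIV. (pf4 f i j k l)\<^sup>2)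
    = ?S + (\<Sum>i\<in>UNIV. \<Sum>j\<in>UNIV. \<Sum>k\<in>UNIV. \<Sum>l\<in>UNIV. ?c i k j l)
         + (\<Sum>i\<in>UNIV. \<Sum>j\<in>UNIV. \<Sum>k\<in>UNIV. \<Sum>l\<in>UNIV. ?c i l j k)"
    by (simp only: sum.distrib)
  also have "(\<Sum>i\<in>UNIV. \<Sum>j\<in>UNIV. \<Sum>k\<in>UNIV. \<Sum>l\<in>UNIV. ?c i k j l) = ?S"
    by (rule sum.cong[OF refl], rule sum.swap)
  also have "(\<Sum>i\<in>UNIV. \<Sum>j\<in>UNIV. \<Sum>k\<in>UNIV. \<Sum>l\<in>UNIV. ?c i l j k)
     = (\<Sum>i\<in>UNIV. \<Sum>j\<in>UNIV. \<Sum>l\<in>UNIV. \<Sum>k\<in>UNIV. ?c i l j k)"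
    by (rule sum.cong[OF refl], rule sum.cong[OF refl], rule sum.swap)
  also have "\<dots> = ?S"
    by (rule sum.cong[OF refl], rule sum.swap)
  finally have "3 * ?S = (\<Sum>i\<in>UNIV. \<Sum>j\<in>UNIV. \<Sum>k\<in>UNIV. \<Sum>l\<in>UNIV. (pf4 f i j k l)\<^sup>2)"
    by simp
  also have "\<dots> \<ge> 0"
    by (intro sum_nonneg) simp
  finally show ?thesis
    unfolding pf4_double_contraction[OF f] by simp
qed

lemma sum_swap_pairs:
  "(\<Sum>k\<in>A. \<Sum>l\<in>B. \<Sum>m\<in>C. \<Sum>n\<in>D. F k l m n)
    = (\<Sum>m\<in>C. \<Sum>n\<in>D. \<Sum>k\<in>A. \<Sum>l\<in>B. F k l m n)"
proof -
  have "(\<Sum>k\<in>A. \<Sum>l\<in>B. \<Sum>m\<in>C. \<Sum>n\<in>D. F k l m n)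
      = (\<Sum>k\<in>A. \<Sum>m\<in>C. \<Sum>n\<in>D. \<Sum>l\<in>B. F k l m n)"
    by (subst (2) sum.swap, subst (3) sum.swap) (rule refl)
  also have "\<dots> = (\<Sum>m\<in>C. \<Sum>n\<in>D. \<Sum>k\<in>A. \<Sum>l\<in>B. F k l m n)"
    by (subst sum.swap, subst (2) sum.swap) (rule refl)
  finally show ?thesis .
qed

text \<open>The vanishing of \<open>pf6 f i j k l m n\<close>, multiplied by \<open>f$k$l * f$m$n\<close> and summed over the last four
indices. The first term of the row expansion contracts to a multiple of \<open>f$i$j\<close>; the other four are
equal up to renaming indices, each being an entry of \<open>f ** (f ** Q)\<close> with \<open>Q\<close> the contraction of \<open>pf4\<close>.\<close>

lemma pfaffian_quintic:
  fixes f :: "real^'n^'n"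
  assumes n: "CARD('n) \<le> 5" and f: "antisymmetric f"
  shows "8 *\<^sub>R (f ** (f ** (f ** (f ** f)))) = (4 * trace (f ** f)) *\<^sub>R (f ** (f ** f))
    - ((trace (f ** f))\<^sup>2 - 2 * trace (f ** (f ** (f ** f)))) *\<^sub>R f"
proof -
  note skew = antisymmetric_nth[OF f]
  let ?t = "trace (f ** f)" and ?u = "trace (f ** (f ** (f ** f)))"
  define Q where "Q = (- ?t) *\<^sub>R f + 2 *\<^sub>R (f ** (f ** f))"
  have Q: "(\<Sum>k\<in>UNIV. \<Sum>l\<in>UNIV. f$k$l * pf4 f i j k l) = Q$i$j" for i j
    by (simp add: pf4_contraction[OF f] Q_def)
  have ffQ: "(\<Sum>k\<in>UNIV. \<Sum>l\<in>UNIV. f$i$k * (f$k$l * Q$l$j)) = (f ** (f ** Q))$i$j" for i j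
    by (simp add: matrix_matrix_mult_def sum_distrib_left)
  have main: "((?t)\<^sup>2 - 2 * ?u) * f$i$j + 4 * (f ** (f ** Q))$i$j = 0" for i j
  proof -
    let ?e1 = "\<lambda>k l m n. f$i$j * (f$k$l * (f$m$n * pf4 f k l m n))"
    let ?e2 = "\<lambda>k l m n. f$i$k * (f$k$l * (f$m$n * pf4 f l j m n))"
    have "f$k$l * (f$m$n * pf6 f i j k l m n)
        = ?e1 k l m n + ?e2 k l m n + ?e2 l k m n + ?e2 m n k l + ?e2 n m k l" for k l m n
      by (simp add: pf6_def pf4_def skew[of l k] skew[of n m] skew[of k j] skew[of l j] skew[of m j]
          skew[of n j] skew[of m k] skew[of m l] skew[of n k] skew[of n l] algebra_simps)
    then have "?e1 k l m n + ?e2 k l m n + ?e2 l k m n + ?e2 m n k l + ?e2 n m k l = 0" for k l m n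
      using pf6_eq_0[OF n f] by (metis mult_zero_right)
    then have "0 = (\<Sum>k\<in>UNIV. \<Sum>l\<in>UNIV. \<Sum>m\<in>UNIV. \<Sum>n\<in>UNIV.
        ?e1 k l m n + ?e2 k l m n + ?e2 l k m n + ?e2 m n k l + ?e2 n m k l)"
      by simp
    also have "\<dots> = (\<Sum>k\<in>UNIV. \<Sum>l\<in>UNIV. \<Sum>m\<in>UNIV. \<Sum>n\<in>UNIV. ?e1 k l m n)
        + (\<Sum>k\<in>UNIV. \<Sum>l\<in>UNIV. \<Sum>m\<in>UNIV. \<Sum>n\<in>UNIV. ?e2 k l m n)
        + (\<Sum>k\<in>UNIV. \<Sum>l\<in>UNIV. \<Sum>m\<in>UNIV. \<Sum>n\<in>UNIV. ?e2 l k m n)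
        + (\<Sum>k\<in>UNIV. \<Sum>l\<in>UNIV. \<Sum>m\<in>UNIV. \<Sum>n\<in>UNIV. ?e2 m n k l)
        + (\<Sum>k\<in>UNIV. \<Sum>l\<in>UNIV. \<Sum>m\<in>UNIV. \<Sum>n\<in>UNIV. ?e2 n m k l)"
      by (simp only: sum.distrib)
    also have "(\<Sum>k\<in>UNIV. \<Sum>l\<in>UNIV. \<Sum>m\<in>UNIV. \<Sum>n\<in>UNIV. ?e1 k l m n) = (?t\<^sup>2 - 2 * ?u) * f$i$j"
      unfolding sum_distrib_left [symmetric]
      by (subst mult.commute) (simp only: sum_distrib_left pf4_double_contraction[OF f])
    also have "(\<Sum>k\<in>UNIV. \<Sum>l\<in>UNIV. \<Sum>m\<in>UNIV. \<Sum>n\<in>UNIV. ?e2 m n k l)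
        = (\<Sum>m\<in>UNIV. \<Sum>n\<in>UNIV. \<Sum>k\<in>UNIV. \<Sum>l\<in>UNIV. ?e2 m n k l)"
      by (rule sum_swap_pairs)
    also have "(\<Sum>k\<in>UNIV. \<Sum>l\<in>UNIV. \<Sum>m\<in>UNIV. \<Sum>n\<in>UNIV. ?e2 n m k l)
        = (\<Sum>n\<in>UNIV. \<Sum>m\<in>UNIV. \<Sum>k\<in>UNIV. \<Sum>l\<in>UNIV. ?e2 n m k l)"
      by (subst sum_swap_pairs, rule sum.swap)
    also have "(\<Sum>k\<in>UNIV. \<Sum>l\<in>UNIV. \<Sum>m\<in>UNIV. \<Sum>n\<in>UNIV. ?e2 l k m n)
        = (\<Sum>l\<in>UNIV. \<Sum>k\<in>UNIV. \<Sum>m\<in>UNIV. \<Sum>n\<in>UNIV. ?e2 l k m n)"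
      by (rule sum.swap)
    also have "(\<Sum>k\<in>UNIV. \<Sum>l\<in>UNIV. \<Sum>m\<in>UNIV. \<Sum>n\<in>UNIV. ?e2 k l m n) = (f ** (f ** Q))$i$j"
      unfolding sum_distrib_left [symmetric] Q by (simp only: sum_distrib_left ffQ)
    finally show ?thesis by simp
  qed
  have "f ** (f ** Q) = (- ?t) *\<^sub>R (f ** (f ** f)) + 2 *\<^sub>R (f ** (f ** (f ** (f ** f))))"
    by (simp only: Q_def matrix_add_ldistrib matrix_scaleR_right)
  then have entry: "(f ** (f ** Q))$i$j
      = - ?t * (f ** (f ** f))$i$j + 2 * (f ** (f ** (f ** (f ** f))))$i$j" for i j
    by simp
  have "8 * (f ** (f ** (f ** (f ** f))))$i$j
      = 4 * ?t * (f ** (f ** f))$i$j - (?t\<^sup>2 - 2 * ?u) * f$i$j" for i j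
    using main[of i j] unfolding entry by (simp add: algebra_simps)
  then show ?thesis
    by (simp add: vec_eq_iff)
qed


section \<open>The sign of the discriminant and of the squared angles\<close>

lemma quintic_traces:
  fixes f :: "real^'n^'n"
  assumes n: "CARD('n) \<le> 5" and f: "antisymmetric f"
  shows "matpow f 5 = (trace (matpow f 2) / 2) *\<^sub>R matpow f 3
    - (1/8 * (trace (matpow f 2))\<^sup>2 - 1/4 * trace (matpow f 4)) *\<^sub>R f"
proof -
  have "matpow f 5 = (1/8) *\<^sub>R (8 *\<^sub>R matpow f 5)"
    by simp
  also have "\<dots> = (trace (matpow f 2) / 2) *\<^sub>R matpow f 3
      - (1/8 * (trace (matpow f 2))\<^sup>2 - 1/4 * trace (matpow f 4)) *\<^sub>R f"
    unfolding matpow_numerals pfaffian_quintic[OF n f] by (simp add: algebra_simps)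
  finally show ?thesis .
qed

text \<open>Since \<open>f\<close> is skew-adjoint and \<open>H = f\<^sup>3 - (t/4) f\<close>, with \<open>t\<close> the trace of \<open>f\<^sup>2\<close>, is a polynomial in \<open>f\<close>, the squared
norm of \<open>H\<close> is the inner product of \<open>f\<close> with \<open>(f\<^sup>2 - t/4) H\<close>. The factor \<open>f\<^sup>2 - t/4\<close> completes the square in the
quintic, so \<open>(f\<^sup>2 - t/4) H\<close> is \<open>f\<close> times a quarter of the discriminant.\<close>

lemma inner_cubic_remainder:
  fixes f :: "real^'n^'n"
  assumes n: "CARD('n) \<le> 5" and f: "antisymmetric f"
  defines "H \<equiv> matpow f 3 - (trace (matpow f 2) / 4) *\<^sub>R f"
  shows "H \<bullet> H = Delta f / 4 * (f \<bullet> f)"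
proof -
  let ?t = "trace (matpow f 2)"
  have "f ** (f ** H) = matpow f 5 - (?t / 4) *\<^sub>R matpow f 3"
    by (simp add: H_def matpow_numerals matrix_diff_ldistrib matrix_scaleR_right)
  also have "\<dots> - (?t / 4) *\<^sub>R H = (Delta f / 4) *\<^sub>R f"
    unfolding quintic_traces[OF n f] H_def Delta_def
    by (simp add: vec_eq_iff field_simps power2_eq_square)
  finally have ffH: "f ** (f ** H) - (?t / 4) *\<^sub>R H = (Delta f / 4) *\<^sub>R f" .
  have "H \<bullet> H = f \<bullet> (f ** (f ** H)) - ?t / 4 * (f \<bullet> H)"
    by (subst (1) H_def) (simp add: matpow_numerals inner_diff_left inner_antisymmetric_mult[OF f])
  also have "\<dots> = f \<bullet> (f ** (f ** H) - (?t / 4) *\<^sub>R H)"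
    by (simp add: inner_diff_right)
  finally show ?thesis
    unfolding ffH by simp
qed

lemma Delta_nonneg:
  fixes f :: "real^'n^'n"
  assumes "CARD('n) \<le> 5" and "antisymmetric f"
  shows "Delta f \<ge> 0"
proof (cases "f = 0")
  case True
  then show ?thesis
    by (simp add: Delta_def matpow_numerals trace_def matrix_matrix_mult_def)
next
  case False
  then have "f \<bullet> f > 0" by simp
  moreover have "Delta f / 4 * (f \<bullet> f) \<ge> 0"
    unfolding inner_cubic_remainder[OF assms, symmetric] by simp
  ultimately show ?thesis
    unfolding zero_le_mult_iff by linarith
qed

lemma cube_of_Delta_eq_0:
  fixes f :: "real^'n^'n"
  assumes "CARD('n) \<le> 5" and "antisymmetric f" and "Delta f = 0"
  shows "matpow f 3 = - (theta_plus_sq f *\<^sub>R f)"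
  using inner_cubic_remainder[OF assms(1,2)] assms(3) by (simp add: theta_plus_sq_def)

text \<open>The Pfaffian inequality says that the discriminant, the squared difference of the squared angles, is at most
their squared sum.\<close>

lemma theta_minus_sq_nonneg:
  fixes f :: "real^'n^'n"
  assumes f: "antisymmetric f"
  shows "theta_minus_sq f \<ge> 0"
proof -
  let ?t = "trace (matpow f 2)"
  have "Delta f \<le> (- ?t / 2)\<^sup>2"
    using trace_fourth_power_le[OF f] by (simp add: Delta_def matpow_numerals power_divide)
  moreover have "- ?t / 2 \<ge> 0"
    by (simp add: trace_square_antisymmetric[OF f])
  ultimately have "sqrt (Delta f) \<le> - ?t / 2"
    by (rule real_le_lsqrt[rotated])
  then show ?thesis
    by (simp add: theta_minus_sq_def)
qed

lemma antisymmetric_quintic: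
  fixes f :: "real^'n^'n"
  assumes n: "CARD('n) \<le> 5" and f: "antisymmetric f"
  shows "matpow f 5 = - ((theta_plus_sq f + theta_minus_sq f) *\<^sub>R matpow f 3)
    - (theta_plus_sq f * theta_minus_sq f) *\<^sub>R f"
proof -
  let ?t = "trace (matpow f 2)"
  have "theta_plus_sq f * theta_minus_sq f = (?t / 4)\<^sup>2 - (sqrt (Delta f))\<^sup>2 / 4"
    by (simp add: theta_plus_sq_def theta_minus_sq_def power2_eq_square algebra_simps)
  also have "\<dots> = 1/8 * ?t\<^sup>2 - 1/4 * trace (matpow f 4)"
    unfolding real_sqrt_pow2[OF Delta_nonneg[OF n f]]
    by (simp add: Delta_def power2_eq_square field_simps)
  finally have prod: "theta_plus_sq f * theta_minus_sq f = \<dots>" .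
  have sum: "theta_plus_sq f + theta_minus_sq f = - (?t / 2)"
    by (simp add: theta_plus_sq_def theta_minus_sq_def)
  show ?thesis
    unfolding prod sum quintic_traces[OF n f] by simp
qed

section \<open>The exponential on an oscillating part\<close>

text \<open>The power \<open>f\<^sup>k U\<close> is \<open>(-\<theta>\<^sup>2)\<^sup>j\<close> times \<open>U\<close> for \<open>k = 2j\<close> and times \<open>f U\<close> for \<open>k = 2j + 1\<close>. The factorial is
shifted by one because \<open>U\<close> will be a summand of \<open>f\<close> and so already accounts for one factor of the power;
this shift is what produces \<open>sin \<theta> / \<theta>\<close> and \<open>(1 - cos \<theta>) / \<theta>\<^sup>2\<close> rather than \<open>cos \<theta>\<close> and \<open>sin \<theta> / \<theta>\<close>.\<close>

lemma sums_exp_tail_oscillating: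
  fixes f U :: "real^'n^'n"
  assumes U: "f ** (f ** U) = - ((\<theta>\<^sup>2) *\<^sub>R U)" and "\<theta> \<noteq> 0"
  shows "(\<lambda>k. (1 / fact (Suc k)) *\<^sub>R (matpow f k ** U)) sums
    ((sin \<theta> / \<theta>) *\<^sub>R U + ((1 - cos \<theta>) / \<theta>\<^sup>2) *\<^sub>R (f ** U))"
proof -
  have even: "matpow f (2 * j) ** U = (- (\<theta>\<^sup>2)) ^ j *\<^sub>R U" for j
  proof (induction j)
    case (Suc j)
    have "matpow f (2 * Suc j) ** U = f ** (f ** (matpow f (2 * j) ** U))"
      by (simp add: matrix_mul_assoc)
    also have "\<dots> = (- (\<theta>\<^sup>2)) ^ j *\<^sub>R (f ** (f ** U))"
      by (simp add: Suc matrix_scaleR_right)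
    also have "\<dots> = (- (\<theta>\<^sup>2)) ^ Suc j *\<^sub>R U"
      by (simp add: U)
    finally show ?case .
  qed simp
  have odd: "matpow f (Suc (2 * j)) ** U = (- (\<theta>\<^sup>2)) ^ j *\<^sub>R (f ** U)" for j
    by (simp add: matrix_mul_assoc [symmetric] even matrix_scaleR_right)
  have coeff: "(1 / fact (Suc k)) *\<^sub>R (matpow f k ** U)
      = (sin_coeff (Suc k) * \<theta> ^ Suc k / \<theta>) *\<^sub>R U
        + (- (cos_coeff (Suc k) * \<theta> ^ Suc k) / \<theta>\<^sup>2) *\<^sub>R (f ** U)" for k
  proof (cases "even k")
    case True
    then obtain j where k: "k = 2 * j" by blast
    show ?thesis
      using \<open>\<theta> \<noteq> 0\<close> unfolding k even
      by (simp add: sin_coeff_def cos_coeff_def power_mult power_minus[of "\<theta>\<^sup>2"])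
  next
    case False
    then obtain j where k: "k = Suc (2 * j)" by (auto elim: oddE)
    show ?thesis
      using \<open>\<theta> \<noteq> 0\<close> unfolding k odd
      by (simp add: sin_coeff_def cos_coeff_def power_mult power_minus[of "\<theta>\<^sup>2" j] power2_eq_square[of \<theta>] power_minus[of "\<theta>*\<theta>" j])
  qed
  have "(\<lambda>k. sin_coeff (Suc k) * \<theta> ^ Suc k) sums sin \<theta>"
    using sin_converges[of \<theta>] by (subst sums_Suc_iff) simp
  moreover have "(\<lambda>k. cos_coeff (Suc k) * \<theta> ^ Suc k) sums (cos \<theta> - 1)"
    using cos_converges[of \<theta>] by (subst sums_Suc_iff) simp
  then have "(\<lambda>k. - (cos_coeff (Suc k) * \<theta> ^ Suc k)) sums (1 - cos \<theta>)"
    using sums_minus by fastforce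
  ultimately show ?thesis
    unfolding coeff by (intro sums_add sums_scaleR_left sums_divide)
qed

text \<open>Splitting the matrix itself, and not the identity, avoids a summand for the kernel of \<open>f\<close>: the constant
term of the series is the only place where the kernel is felt.\<close>

lemma matexp_sum_oscillating:
  fixes f :: "real^'n^'n"
  assumes "finite I" and f: "f = (\<Sum>i\<in>I. U i)"
    and U: "\<And>i. i \<in> I \<Longrightarrow> f ** (f ** U i) = - ((\<theta> i)\<^sup>2 *\<^sub>R U i)"
    and "\<And>i. i \<in> I \<Longrightarrow> \<theta> i \<noteq> 0"
  shows "matexp f = mat 1 + (\<Sum>i\<in>I. (sin (\<theta> i) / \<theta> i) *\<^sub>R U i
            + ((1 - cos (\<theta> i)) / (\<theta> i)\<^sup>2) *\<^sub>R (f ** U i))"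
proof -
  have pow: "matpow f (Suc k) = (\<Sum>i\<in>I. matpow f k ** U i)" for k
  proof -
    have "matpow f (Suc k) = matpow f k ** f"
      by (induction k) (simp_all add: matrix_mul_assoc)
    also have "\<dots> = matpow f k ** (\<Sum>i\<in>I. U i)"
      using f by simp
    also have "\<dots> = (\<Sum>i\<in>I. matpow f k ** U i)"
      by (simp add: matrix_matrix_mult_def vec_eq_iff sum_distrib_left sum.swap[of _ I])
    finally show ?thesis .
  qed
  have "(\<lambda>k. (1 / fact (Suc k)) *\<^sub>R matpow f (Suc k)) sums
      (\<Sum>i\<in>I. (sin (\<theta> i) / \<theta> i) *\<^sub>R U i + ((1 - cos (\<theta> i)) / (\<theta> i)\<^sup>2) *\<^sub>R (f ** U i))"
    unfolding pow scaleR_right.sum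
    by (intro sums_sum sums_exp_tail_oscillating assms)
  then have "(\<lambda>k. (1 / fact k) *\<^sub>R matpow f k) sums
      ((\<Sum>i\<in>I. (sin (\<theta> i) / \<theta> i) *\<^sub>R U i + ((1 - cos (\<theta> i)) / (\<theta> i)\<^sup>2) *\<^sub>R (f ** U i)) + mat 1)"
    using sums_Suc[of "\<lambda>k. (1 / fact k) *\<^sub>R matpow f k"] by simp
  then show ?thesis
    unfolding matexp_def by (simp add: sums_iff add.commute)
qed

section \<open>The exponential of an antisymmetric matrix\<close>

text \<open>The two parts come from the factorisation \<open>x (x\<^sup>2 + \<alpha>\<^sup>2) (x\<^sup>2 + \<beta>\<^sup>2)\<close> of the quintic: multiplying \<open>f\<close> by one
quadratic factor leaves a matrix annihilated by the other.\<close>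

lemma matexp_of_quintic:
  fixes f :: "real^'n^'n"
  assumes quintic: "matpow f 5 = - ((\<alpha>\<^sup>2 + \<beta>\<^sup>2) *\<^sub>R matpow f 3) - (\<alpha>\<^sup>2 * \<beta>\<^sup>2) *\<^sub>R f"
    and d: "d = \<alpha>\<^sup>2 - \<beta>\<^sup>2" "d \<noteq> 0" and nz: "\<alpha> \<noteq> 0" "\<beta> \<noteq> 0"
  shows "matexp f = mat 1 + (1 / d) *\<^sub>R
      ((\<alpha>\<^sup>2 * (sin \<beta> / \<beta>) - \<beta>\<^sup>2 * (sin \<alpha> / \<alpha>)) *\<^sub>R f
      + (\<alpha>\<^sup>2 * ((1 - cos \<beta>) / \<beta>\<^sup>2) - \<beta>\<^sup>2 * ((1 - cos \<alpha>) / \<alpha>\<^sup>2)) *\<^sub>R matpow f 2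
      + (sin \<beta> / \<beta> - sin \<alpha> / \<alpha>) *\<^sub>R matpow f 3
      + ((1 - cos \<beta>) / \<beta>\<^sup>2 - (1 - cos \<alpha>) / \<alpha>\<^sup>2) *\<^sub>R matpow f 4)"
proof -
  \<comment> \<open>The two parts are indexed by truth values: \<open>True\<close> rotates by \<open>\<beta>\<close> and \<open>False\<close> by \<open>\<alpha>\<close>.\<close>
  define U where "U = (\<lambda>i. if i then (1 / d) *\<^sub>R (matpow f 3 + \<alpha>\<^sup>2 *\<^sub>R f)
                            else (- 1 / d) *\<^sub>R (matpow f 3 + \<beta>\<^sup>2 *\<^sub>R f))"
  define \<theta> where "\<theta> = (\<lambda>i. if i then \<beta> else \<alpha>)"
  define s\<^sub>\<alpha> where "s\<^sub>\<alpha> = sin \<alpha> / \<alpha>"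
  define c\<^sub>\<alpha> where "c\<^sub>\<alpha> = (1 - cos \<alpha>) / \<alpha>\<^sup>2"
  define s\<^sub>\<beta> where "s\<^sub>\<beta> = sin \<beta> / \<beta>"
  define c\<^sub>\<beta> where "c\<^sub>\<beta> = (1 - cos \<beta>) / \<beta>\<^sup>2"
  have split: "f = (\<Sum>i\<in>UNIV. U i)"
  proof -
    have "(\<Sum>i\<in>UNIV. U i) = ((\<alpha>\<^sup>2 - \<beta>\<^sup>2) / d) *\<^sub>R f"
      by (simp add: UNIV_bool U_def diff_divide_distrib algebra_simps)
    then show ?thesis using d by simp
  qed
  have fU: "f ** U i = (if i then (1 / d) *\<^sub>R (matpow f 4 + \<alpha>\<^sup>2 *\<^sub>R matpow f 2)
                            else (- 1 / d) *\<^sub>R (matpow f 4 + \<beta>\<^sup>2 *\<^sub>R matpow f 2))" for i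
    by (simp only: U_def matpow_numerals matrix_add_ldistrib matrix_scaleR_right split: if_split) simp
  have "f ** (f ** U i) = (if i then (1 / d) *\<^sub>R (matpow f 5 + \<alpha>\<^sup>2 *\<^sub>R matpow f 3)
                                else (- 1 / d) *\<^sub>R (matpow f 5 + \<beta>\<^sup>2 *\<^sub>R matpow f 3))" for i
    by (simp only: fU matpow_numerals matrix_add_ldistrib matrix_scaleR_right split: if_split) simp
  then have osc: "f ** (f ** U i) = - ((\<theta> i)\<^sup>2 *\<^sub>R U i)" for i
    unfolding quintic by (simp add: U_def \<theta>_def algebra_simps)
  have "matexp f = mat 1 + (\<Sum>i\<in>UNIV. (sin (\<theta> i) / \<theta> i) *\<^sub>R U i
            + ((1 - cos (\<theta> i)) / (\<theta> i)\<^sup>2) *\<^sub>R (f ** U i))"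
    by (rule matexp_sum_oscillating) (use split osc nz in \<open>simp_all add: \<theta>_def\<close>)
  also have "\<dots> = mat 1
      + (s\<^sub>\<beta> *\<^sub>R U True + c\<^sub>\<beta> *\<^sub>R (f ** U True) + (s\<^sub>\<alpha> *\<^sub>R U False + c\<^sub>\<alpha> *\<^sub>R (f ** U False)))"
    by (simp add: UNIV_bool \<theta>_def s\<^sub>\<alpha>_def c\<^sub>\<alpha>_def s\<^sub>\<beta>_def c\<^sub>\<beta>_def add_ac)
  finally show ?thesis
    unfolding fU s\<^sub>\<alpha>_def [symmetric] c\<^sub>\<alpha>_def [symmetric] s\<^sub>\<beta>_def [symmetric] c\<^sub>\<beta>_def [symmetric]
    by (simp add: U_def algebra_simps)
qed

theorem theorem5p1:
  fixes f :: "real^'n^'n"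
  assumes "CARD('n) \<in> {4, 5}"
    and "antisymmetric f"
  shows "Delta f \<ge> 0 \<and> theta_plus_sq f \<ge> 0 \<and> theta_minus_sq f \<ge> 0 \<and>
    (Delta f \<noteq> 0 \<and> theta_plus f \<noteq> 0 \<and> theta_minus f \<noteq> 0 \<longrightarrow>
      matexp f = mat 1 + (1 / sqrt (Delta f)) *\<^sub>R
        (coeff_A f *\<^sub>R f + coeff_B f *\<^sub>R matpow f 2
          + coeff_C f *\<^sub>R matpow f 3 + coeff_D f *\<^sub>R matpow f 4)) \<and>
    (Delta f = 0 \<and> theta_plus f \<noteq> 0 \<longrightarrow>
      matexp f = mat 1 + (sin (theta_plus f) / theta_plus f) *\<^sub>R f
        + ((1 - cos (theta_plus f)) / theta_plus_sq f) *\<^sub>R matpow f 2)"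
proof (intro conjI impI; (elim conjE)?)
  have n: "CARD('n) \<le> 5" and f: "antisymmetric f"
    using assms by auto
  show \<Delta>: "Delta f \<ge> 0"
    by (rule Delta_nonneg[OF n f])
  show minus: "theta_minus_sq f \<ge> 0"
    by (rule theta_minus_sq_nonneg[OF f])
  have diff: "theta_plus_sq f - theta_minus_sq f = sqrt (Delta f)"
    by (simp add: theta_plus_sq_def theta_minus_sq_def)
  show plus: "theta_plus_sq f \<ge> 0"
    using diff minus \<Delta> real_sqrt_ge_zero[OF \<Delta>] by linarith
  have sq: "(theta_plus f)\<^sup>2 = theta_plus_sq f" "(theta_minus f)\<^sup>2 = theta_minus_sq f"
    using plus minus by (simp_all add: theta_plus_def theta_minus_def)
  show "matexp f = mat 1 + (1 / sqrt (Delta f)) *\<^sub>R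
      (coeff_A f *\<^sub>R f + coeff_B f *\<^sub>R matpow f 2
        + coeff_C f *\<^sub>R matpow f 3 + coeff_D f *\<^sub>R matpow f 4)"
    if "Delta f \<noteq> 0" "theta_plus f \<noteq> 0" "theta_minus f \<noteq> 0"
    using matexp_of_quintic[of f "theta_plus f" "theta_minus f" "sqrt (Delta f)"] that diff
      antisymmetric_quintic[OF n f]
    by (simp add: sq coeff_A_def coeff_B_def coeff_C_def coeff_D_def)
  show "matexp f = mat 1 + (sin (theta_plus f) / theta_plus f) *\<^sub>R f
      + ((1 - cos (theta_plus f)) / theta_plus_sq f) *\<^sub>R matpow f 2"
    if "Delta f = 0" "theta_plus f \<noteq> 0"
    using matexp_sum_oscillating[of "{()}" f "\<lambda>_. f" "\<lambda>_. theta_plus f"]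
      cube_of_Delta_eq_0[OF n f that(1)] that(2)
    by (simp add: sq matpow_numerals add.assoc)
qed

end
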